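(* Let $M, N$ be positive integers and let $Y \subseteq \mathbb{Z}^N$ be a finite, nonempty set with difference set $X = Y - Y = \{y - y' : y, y' \in Y\}$. Then for every $M\times N$ matrix $A \in (\mathbb{R}/\mathbb{Z})^{MN}$, $$|Y|\left(\frac{\log |Y|}{M}\right)^M - |Y| \le \sum_{\substack{\xi \in X\\ \xi \ne 0}} F(A\xi).$$
   Context: For $x \in \mathbb{R}/\mathbb{Z}$, $\|x\|$ is the distance from (any real representative of) $x$ to the nearest integer. Elements of $G_1 = (\mathbb{R}/\mathbb{Z})^{MN}$ are written as $M\times N$ matrices $A = (\alpha_{mn})$ with entries in $\mathbb{R}/\mathbb{Z}$; elements of $G_2 = (\mathbb{R}/\mathbb{Z})^M$ are written as column vectors. For a column vector $\xi \in \mathbb{Z}^N$, $A\xi = \bigl(\sum_{n=1}^N \alpha_{mn}\xi_n\bigr)_{1\le m\le M} \in G_2$. The function $F : G_2 \to [1,\infty]$ is $$F(x) = \prod_{m=1}^M (2\|x_m\|)^{-1},$$ with value $+\infty$ if some $\|x_m\|=0$. *)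

theory Defs
  imports "HOL-Analysis.Finite_Cartesian_Product" "HOL-Library.Extended_Real"
begin

text \<open>The relation whose quotient is \<open>\<real>/\<int>\<close>.\<close>

definition cong_Ints :: "real \<Rightarrow> real \<Rightarrow> bool"
  where "cong_Ints x y \<longleftrightarrow> x - y \<in> \<int>"

lemma equivp_cong_Ints: "equivp cong_Ints"
proof (rule equivpI)
  show "reflp cong_Ints"
    by (simp add: reflp_def cong_Ints_def)
  show "symp cong_Ints"
    by (metis Ints_minus cong_Ints_def minus_diff_eq sympI)
  show "transp cong_Ints"
  proof (rule transpI)
    fix x y z assume "cong_Ints x y" "cong_Ints y z"
    then have "(x - y) + (y - z) \<in> \<int>"
      unfolding cong_Ints_def by (rule Ints_add)
    then show "cong_Ints x z"
      by (simp add: cong_Ints_def)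
  qed
qed

quotient_type real_mod_int = real / cong_Ints
  by (rule equivp_cong_Ints)

instantiation real_mod_int :: ab_group_add
begin

lift_definition zero_real_mod_int :: real_mod_int is "0 :: real" .

lift_definition plus_real_mod_int :: "real_mod_int \<Rightarrow> real_mod_int \<Rightarrow> real_mod_int"
  is "(+) :: real \<Rightarrow> real \<Rightarrow> real"
  unfolding cong_Ints_def by (metis Ints_add add_diff_add)

lift_definition uminus_real_mod_int :: "real_mod_int \<Rightarrow> real_mod_int"
  is "uminus :: real \<Rightarrow> real"
  unfolding cong_Ints_def by (metis Ints_minus minus_diff_minus)

lift_definition minus_real_mod_int :: "real_mod_int \<Rightarrow> real_mod_int \<Rightarrow> real_mod_int"
  is "(-) :: real \<Rightarrow> real \<Rightarrow> real"
  unfolding cong_Ints_def by (metis Ints_diff diff_diff_eq2 diff_diff_eq add_diff_eq diff_add_eq add.commute)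

instance
  by standard (transfer; simp add: cong_Ints_def)+

end

lift_definition int_scale :: "int \<Rightarrow> real_mod_int \<Rightarrow> real_mod_int"
  is "\<lambda>k x. of_int k * x"
  unfolding cong_Ints_def by (metis Ints_mult Ints_of_int right_diff_distrib)

text \<open>\<open>\<parallel>x\<parallel>\<close>; any tie-breaking in \<^const>\<open>round\<close> is irrelevant to the distance.\<close>

lift_definition dist_to_int :: "real_mod_int \<Rightarrow> real"
  is "\<lambda>x. \<bar>x - of_int (round x)\<bar>"
proof -
  fix x y :: real
  assume "cong_Ints x y"
  then obtain k where "x - y = of_int k"
    unfolding cong_Ints_def by (rule Ints_cases)
  then have x: "x = y + of_int k"
    by simp
  have "round x = round y + k"
    unfolding x round_def by (metis add.assoc add.commute floor_add_int)
  then show "\<bar>x - of_int (round x)\<bar> = \<bar>y - of_int (round y)\<bar>"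
    by (simp add: x)
qed

definition mat_int_vec :: "real_mod_int ^ 'n ^ 'm \<Rightarrow> int ^ 'n \<Rightarrow> real_mod_int ^ 'm"
  where "mat_int_vec A \<xi> = (\<chi> m. \<Sum>n\<in>UNIV. int_scale (\<xi> $ n) (A $ m $ n))"

definition F :: "real_mod_int ^ 'm \<Rightarrow> ereal"
  where "F x = (if \<exists>m. dist_to_int (x $ m) = 0 then \<infinity>
                else ereal (\<Prod>m\<in>UNIV. inverse (2 * dist_to_int (x $ m))))"

text \<open>\<open>Y - Y\<close> in the sense of Minkowski; \<open>-\<close> on sets is already the set-theoretic difference.\<close>

definition difference_set :: "('a::minus) set \<Rightarrow> 'a set"
  where "difference_set Y = {y - y' | y y'. y \<in> Y \<and> y' \<in> Y}"

end

theory Submission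
  imports Defs "HOL-Analysis.Analysis"
begin

text \<open>
  The tent \<open>max 0 (1 - n\<parallel>x\<parallel>)\<close> on \<open>\<real>/\<int>\<close>, \<open>n \<ge> 2\<close>, is \<open>n\<close> times the autocorrelation of the
  indicator function of an arc of length \<open>1/n\<close>. It is therefore positive definite, and remains so
  after subtracting its mean \<open>1/n\<close>. The function \<open>g = 1 + (\<Sum>n=2..L. tent n)\<close> satisfies
  \<open>g(0) = L\<close>, has mean \<open>harm L \<ge> ln (L + 1)\<close> and lies below \<open>1 / (2\<parallel>x\<parallel>)\<close>. By a Schur product
  argument over the \<open>M\<close> coordinates, the sum of \<open>\<Prod>m. g((Ay - Az)\<^sub>m)\<close> over \<open>y, z \<in> Y\<close> is at least
  \<open>|Y|\<^sup>2 (harm L)\<^sup>M\<close>. With \<open>L = \<lfloor>|Y|\<^bsup>1/M\<^esup>\<rfloor>\<close> its diagonal contributes at most \<open>|Y|\<^sup>2\<close>, and each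
  \<open>\<xi> \<noteq> 0\<close> is a difference in at most \<open>|Y|\<close> ways.
\<close>

section \<open>Positive semidefinite kernels\<close>

definition psd_on :: "'a set \<Rightarrow> ('a \<Rightarrow> 'a \<Rightarrow> real) \<Rightarrow> bool"
  where "psd_on S Q \<longleftrightarrow> (\<forall>w. 0 \<le> (\<Sum>y\<in>S. \<Sum>z\<in>S. w y * w z * Q y z))"

lemma psd_onD: "psd_on S Q \<Longrightarrow> 0 \<le> (\<Sum>y\<in>S. \<Sum>z\<in>S. w y * w z * Q y z)"
  unfolding psd_on_def by blast

lemma psd_on_add:
  assumes "psd_on S P" "psd_on S Q"
  shows "psd_on S (\<lambda>y z. P y z + Q y z)"
  using assms unfolding psd_on_def by (simp add: ring_distribs sum.distrib)

lemma psd_on_scale: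
  assumes "psd_on S P" "0 \<le> c"
  shows "psd_on S (\<lambda>y z. c * P y z)"
proof -
  have "(\<Sum>y\<in>S. \<Sum>z\<in>S. w y * w z * (c * P y z)) = c * (\<Sum>y\<in>S. \<Sum>z\<in>S. w y * w z * P y z)" for w
    by (simp add: sum_distrib_left mult_ac)
  then show ?thesis using assms unfolding psd_on_def by simp
qed

lemma psd_on_zero: "psd_on S (\<lambda>y z. 0)"
  by (simp add: psd_on_def)

lemma psd_on_sum:
  assumes "\<And>i. i \<in> I \<Longrightarrow> psd_on S (P i)"
  shows "psd_on S (\<lambda>y z. \<Sum>i\<in>I. P i y z)"
  using assms by (induction I rule: infinite_finite_induct) (simp_all add: psd_on_zero psd_on_add)

lemma psd_on_const:
  assumes "0 \<le> c"
  shows "psd_on S (\<lambda>y z. c)"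
proof -
  have "(\<Sum>y\<in>S. \<Sum>z\<in>S. w y * w z * 1) = (\<Sum>y\<in>S. w y)\<^sup>2" for w :: "'a \<Rightarrow> real"
    by (simp add: power2_eq_square sum_product)
  then have "psd_on S (\<lambda>y z. 1)" unfolding psd_on_def by simp
  from psd_on_scale[OF this assms] show ?thesis by simp
qed

text \<open>For fixed \<open>u\<close> the rank-one kernel \<open>f y u * f z u\<close> can be
  absorbed into the weights, which become \<open>w y * f y u\<close>. Positivity of \<open>Q\<close>
  thus makes the integrand nonnegative at every \<open>u\<close>. This is the Schur product of
  \<open>Q\<close> with a Gram kernel.\<close>

lemma psd_on_mult_integral:
  fixes f :: "'a \<Rightarrow> 'b \<Rightarrow> real"
  assumes Q: "psd_on S Q"
    and int: "\<And>y z. y \<in> S \<Longrightarrow> z \<in> S \<Longrightarrow> integrable N (\<lambda>u. f y u * f z u)"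
  shows "psd_on S (\<lambda>y z. (\<integral>u. f y u * f z u \<partial>N) * Q y z)"
  unfolding psd_on_def
proof
  fix w
  have "0 \<le> (\<integral>u. (\<Sum>y\<in>S. \<Sum>z\<in>S. (w y * f y u) * (w z * f z u) * Q y z) \<partial>N)"
    by (intro integral_nonneg_AE AE_I2 psd_onD[OF Q])
  also have "\<dots> = (\<integral>u. (\<Sum>y\<in>S. \<Sum>z\<in>S. (w y * w z * Q y z) * (f y u * f z u)) \<partial>N)"
    by (simp add: mult_ac)
  also have "\<dots> = (\<Sum>y\<in>S. \<Sum>z\<in>S. (w y * w z * Q y z) * (\<integral>u. f y u * f z u \<partial>N))"
    using int by (simp add: Bochner_Integration.integral_sum)
  also have "\<dots> = (\<Sum>y\<in>S. \<Sum>z\<in>S. w y * w z * ((\<integral>u. f y u * f z u \<partial>N) * Q y z))"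
    by (simp add: mult_ac)
  finally show "0 \<le> (\<Sum>y\<in>S. \<Sum>z\<in>S. w y * w z * ((\<integral>u. f y u * f z u \<partial>N) * Q y z))" .
qed

text \<open>
  The hypothesis \<open>step\<close> stands in for the Schur product theorem, whose general form would need a
  Gram decomposition of \<open>G i - c\<close>.
\<close>

lemma psd_on_prod_minus:
  fixes G :: "'i \<Rightarrow> 'a \<Rightarrow> 'a \<Rightarrow> real"
  assumes c: "0 \<le> c"
    and step: "\<And>i Q. i \<in> I \<Longrightarrow> psd_on S Q \<Longrightarrow> psd_on S (\<lambda>y z. (G i y z - c) * Q y z)"
  shows "psd_on S (\<lambda>y z. (\<Prod>i\<in>I. G i y z) - c ^ card I)"
  using step
proof (induction I rule: infinite_finite_induct)
  case (insert i I)
  let ?P = "\<lambda>y z. \<Prod>i\<in>I. G i y z"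
  have IH: "psd_on S (\<lambda>y z. ?P y z - c ^ card I)"
    using insert by simp
  have "psd_on S ?P"
    using psd_on_add[OF IH psd_on_const[of "c ^ card I"]] c by simp
  with insert.prems have "psd_on S (\<lambda>y z. (G i y z - c) * ?P y z)"
    by blast
  \<comment> \<open>With \<open>P\<close> the product over \<open>I\<close> and
    \<open>k = card I\<close>, \<open>G * P - c^(k+1) = (G - c) * P + c * (P - c^k)\<close>.\<close>
  from psd_on_add[OF this psd_on_scale[OF IH c]] insert.hyps show ?case
    by (simp add: algebra_simps)
qed (simp_all add: psd_on_zero)

section \<open>Arcs on the circle and the measure of their overlap\<close>

definition circle_arc :: "real \<Rightarrow> real \<Rightarrow> real set"
  where "circle_arc \<delta> x = {u \<in> {0..<1}. frac (u - x) < \<delta>}"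

lemma frac_borel_measurable [measurable]: "frac \<in> borel_measurable (borel :: real measure)"
  unfolding frac_def by measurable

lemma lmeasurable_borel_subset_unit:
  fixes A :: "real set"
  assumes "A \<in> sets borel" "A \<subseteq> {0..<1}"
  shows "A \<in> lmeasurable"
proof (rule bounded_set_imp_lmeasurable)
  show "bounded A"
    by (rule bounded_subset[OF _ assms(2)]) (rule bounded_subset[of "{0..1}"], auto)
  show "A \<in> sets lebesgue"
    using assms(1) by (simp add: sets_completionI_sets)
qed

text \<open>Rotation invariance on the circle, with \<open>{0..<1}\<close> as fundamental domain:
  cut it at \<open>1 - x\<close>, translate the left piece by \<open>x\<close> and the right piece
  by \<open>x - 1\<close>, which wraps it around.\<close>

lemma measure_periodic_shift:
  fixes x :: real
  assumes x: "0 \<le> x" "x < 1" and P: "\<And>v. P (v + 1) = P v" and [measurable]: "Measurable.pred borel P"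
  shows "measure lebesgue {u \<in> {0..<1}. P (u - x)} = measure lebesgue {v \<in> {0..<1}. P v}"
proof -
  have add: "measure lebesgue (A \<union> B) = measure lebesgue A + measure lebesgue B"
    if "A \<in> lmeasurable" "B \<in> lmeasurable" "A \<inter> B = {}" for A B :: "real set"
    using that by (simp add: measure_Un3)
  let ?A = "{v \<in> {0..<1-x}. P v}" and ?B = "{v \<in> {1-x..<1}. P v}"
  have AB: "?A \<in> lmeasurable" "?B \<in> lmeasurable"
    using x by (auto intro!: lmeasurable_borel_subset_unit)
  have "{u \<in> {0..<1}. P (u - x)} = (+) x ` ?A \<union> (+) (x - 1) ` ?B"
  proof (intro set_eqI iffI)
    fix u assume u: "u \<in> {u \<in> {0..<1}. P (u - x)}"
    show "u \<in> (+) x ` ?A \<union> (+) (x - 1) ` ?B"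
    proof (cases "u < x")
      case True
      then have "u - x + 1 \<in> ?B" using u P[of "u - x"] by auto
      then have "(x - 1) + (u - x + 1) \<in> (+) (x - 1) ` ?B" by (rule imageI)
      then show ?thesis by simp
    next
      case False
      then have "u - x \<in> ?A" using u by auto
      then have "x + (u - x) \<in> (+) x ` ?A" by (rule imageI)
      then show ?thesis by simp
    qed
  next
    fix u assume "u \<in> (+) x ` ?A \<union> (+) (x - 1) ` ?B"
    then consider v where "v \<in> ?A" "u = x + v" | v where "v \<in> ?B" "u = x - 1 + v"
      by blast
    then show "u \<in> {u \<in> {0..<1}. P (u - x)}"
    proof cases
      case 1
      then show ?thesis using x by simp
    next
      case 2
      then show ?thesis using x P[of "v - 1"] by simp
    qed
  qed
  moreover have "measure lebesgue ((+) x ` ?A \<union> (+) (x - 1) ` ?B)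
      = measure lebesgue ((+) x ` ?A) + measure lebesgue ((+) (x - 1) ` ?B)"
    using x by (intro add measurable_translation AB) auto
  moreover have "measure lebesgue (?A \<union> ?B) = measure lebesgue ?A + measure lebesgue ?B"
    using x by (intro add AB) auto
  moreover have "?A \<union> ?B = {v \<in> {0..<1}. P v}"
    using x by auto
  ultimately show ?thesis
    by (simp add: measure_translation)
qed

text \<open>Rotated by \<open>-x\<close>, the arcs start at \<open>0\<close> and \<open>-e\<close>,
  where \<open>e\<close> is \<open>x - y\<close> reduced to at most 1/2 in absolute value. As
  \<open>\<delta>\<close> is at most 1/2, they cannot overlap at both ends, so they meet in a single
  interval.\<close>

lemma measure_circle_arc_Int:
  fixes x y :: real
  assumes x: "0 \<le> x" "x < 1" and \<delta>: "0 < \<delta>" "\<delta> \<le> 1/2"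
  shows "measure lebesgue (circle_arc \<delta> x \<inter> circle_arc \<delta> y) = max 0 (\<delta> - \<bar>(x - y) - of_int (round (x - y))\<bar>)"
proof -
  define k e where "k = round (x - y)" and "e = (x - y) - of_int k"
  have e: "\<bar>e\<bar> \<le> 1/2"
    unfolding e_def k_def using of_int_round_abs_le[of "x - y"] by linarith
  define P where "P = (\<lambda>v. frac v < \<delta> \<and> frac (v + e) < \<delta>)"
  have P1: "P (v + 1) = P v" for v
    using frac_1_eq[of v] frac_1_eq[of "v + e"] by (simp add: P_def add_ac)
  have [measurable]: "Measurable.pred borel P"
    unfolding P_def by measurable
  have "frac (u - y) = frac (u - x + e)" for u
    using frac_add_of_int_right[of "u - y" "- k"] by (simp add: e_def algebra_simps)
  then have "circle_arc \<delta> x \<inter> circle_arc \<delta> y = {u \<in> {0..<1}. P (u - x)}"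
    by (auto simp: circle_arc_def P_def)
  moreover have "measure lebesgue {u \<in> {0..<1}. P (u - x)} = measure lebesgue {v \<in> {0..<1}. P v}"
    by (rule measure_periodic_shift) (use x P1 in auto)
  moreover have "{v \<in> {0..<1}. P v} = {max 0 (-e)..<min \<delta> (\<delta> - e)}"
  proof -
    have "0 \<le> v \<and> v < 1 \<and> P v \<longleftrightarrow> max 0 (-e) \<le> v \<and> v < min \<delta> (\<delta> - e)" for v
    proof (cases "0 \<le> v \<and> v < \<delta>")
      case True
      then have fv: "frac v = v" using \<delta> by (simp add: frac_eq)
      show ?thesis
      \<comment> \<open>If \<open>v + e\<close> is negative, it wraps to \<open>v + e + 1\<close>,
        which is at least 1/2 and hence at least \<open>\<delta>\<close>: \<open>v\<close> misses
        the second arc.\<close>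
      proof (cases "v + e < 0")
        case neg: True
        then have "frac (v + e) = v + e + 1"
          using True e by (intro frac_unique_iff[THEN iffD2]) auto
        then show ?thesis using True \<delta> e neg fv by (auto simp: P_def)
      next
        case nonneg: False
        then have "frac (v + e) = v + e \<or> v + e = 1"
          using True e \<delta> by (auto simp: frac_eq)
        then show ?thesis using True \<delta> e nonneg fv by (auto simp: P_def)
      qed
    next
      case False
      then show ?thesis using \<delta> by (auto simp: P_def frac_eq)
    qed
    then show ?thesis
      by (intro set_eqI) (simp only: mem_Collect_eq atLeastLessThan_iff conj_assoc)
  qed
  ultimately have "measure lebesgue (circle_arc \<delta> x \<inter> circle_arc \<delta> y) = max 0 (\<delta> - \<bar>e\<bar>)"
    by (simp add: max_def min_def)
  then show ?thesis
    by (simp only: e_def k_def)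
qed

lemma circle_arc_lmeasurable: "circle_arc \<delta> x \<in> lmeasurable"
proof (rule lmeasurable_borel_subset_unit)
  show "circle_arc \<delta> x \<in> sets borel"
    unfolding circle_arc_def by measurable
qed (auto simp: circle_arc_def)

lemma ex_unit_representative: "\<exists>x. 0 \<le> x \<and> x < 1 \<and> abs_real_mod_int x = a"
proof (induction a)
  case (1 r)
  have "cong_Ints (frac r) r"
    by (simp add: cong_Ints_def frac_def)
  then have "abs_real_mod_int (frac r) = abs_real_mod_int r"
    by (simp add: real_mod_int.abs_eq_iff)
  then show ?case
    using frac_ge_0 frac_lt_1 by blast
qed

lemma dist_to_int_le_half: "dist_to_int a \<le> 1/2"
  by transfer (metis abs_minus_commute of_int_round_abs_le)

lemma dist_to_int_nonneg: "0 \<le> dist_to_int a"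
  by transfer simp

lemma dist_to_int_zero [simp]: "dist_to_int 0 = 0"
  by transfer simp

section \<open>Tents, their sum and its bound by 1/(2t)\<close>

definition tent :: "nat \<Rightarrow> real \<Rightarrow> real"
  where "tent n t = max 0 (1 - real n * t)"

text \<open>Up to the factor \<open>n\<close>, the tent minus its mean is the Gram kernel of the
  centred indicators of arcs of length \<open>1/n\<close>, so \<open>psd_on_mult_integral\<close>
  applies.\<close>

lemma psd_on_tent_mult:
  assumes Q: "psd_on S Q" and n: "2 \<le> n"
  shows "psd_on S (\<lambda>y z. (tent n (dist_to_int (a y - a z)) - 1 / real n) * Q y z)"
proof -
  define \<delta> where "\<delta> = 1 / real n"
  have \<delta>: "0 < \<delta>" "\<delta> \<le> 1/2"
    using n by (auto simp: \<delta>_def field_simps)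
  have "\<forall>y. \<exists>r. 0 \<le> r \<and> r < 1 \<and> abs_real_mod_int r = a y"
    using ex_unit_representative by blast
  then obtain x where x: "\<And>y. 0 \<le> x y" "\<And>y. x y < 1" "\<And>y. abs_real_mod_int (x y) = a y"
    unfolding choice_iff by blast
  let ?U = "{0..<1::real}" and ?S = "\<lambda>y. circle_arc \<delta> (x y)"
  have [simp]: "?S y \<in> lmeasurable" "?U \<in> lmeasurable" for y
    by (rule circle_arc_lmeasurable) (rule lmeasurable_borel_subset_unit, auto)
  have [simp]: "?S y \<inter> ?S z \<in> lmeasurable" for y z
    by (rule fmeasurable.Int) simp_all
  have sub: "?S y \<subseteq> ?U" for y
    by (auto simp: circle_arc_def)
  \<comment> \<open>Subtracting the mean \<open>\<delta>\<close> over one period lowers each inner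
    product by \<open>\<delta>\<^sup>2\<close>, which becomes \<open>1/n\<close> after scaling by
    \<open>n\<close>.\<close>
  define f where "f = (\<lambda>y u. indicator (?S y) u - \<delta> * indicator ?U u)"
  have ff: "f y u * f z u = indicator (?S y \<inter> ?S z) u - \<delta> * indicator (?S y) u
      - \<delta> * indicator (?S z) u + \<delta>\<^sup>2 * indicator ?U u" for y z u
    using sub[of y] sub[of z] by (auto simp: f_def indicator_def algebra_simps power2_eq_square)
  have d: "\<bar>x y - x z - of_int (round (x y - x z))\<bar> = dist_to_int (a y - a z)" for y z
    using x(3)[of y, symmetric] x(3)[of z, symmetric]
    by (simp add: minus_real_mod_int.abs_eq dist_to_int.abs_eq)
  have mi: "measure lebesgue (?S y \<inter> ?S z) = max 0 (\<delta> - dist_to_int (a y - a z))" for y z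
    using measure_circle_arc_Int[OF x(1,2) \<delta>, of y "x z"] d by simp
  have ms: "measure lebesgue (?S y) = \<delta>" for y
    using mi[of y y] \<delta> by simp
  have int: "integrable lebesgue (indicator A :: real \<Rightarrow> real)" if "A \<in> lmeasurable" for A
    using fmeasurableD[OF that] fmeasurableD2[OF that] by (simp add: less_top)
  have "integrable lebesgue (\<lambda>u. f y u * f z u)" for y z
    unfolding ff by (intro Bochner_Integration.integrable_add Bochner_Integration.integrable_diff
        integrable_mult_right int) simp_all
  from psd_on_mult_integral[OF Q this]
  have "psd_on S (\<lambda>y z. (\<integral>u. f y u * f z u \<partial>lebesgue) * Q y z)" .
  moreover have "(\<integral>u. f y u * f z u \<partial>lebesgue) = max 0 (\<delta> - dist_to_int (a y - a z)) - \<delta>\<^sup>2" for y z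
    unfolding ff by (simp add: int ms mi power2_eq_square)
  ultimately have "psd_on S (\<lambda>y z. real n * ((max 0 (\<delta> - dist_to_int (a y - a z)) - \<delta>\<^sup>2) * Q y z))"
    by (intro psd_on_scale) simp_all
  moreover have "real n * (max 0 (\<delta> - t) - \<delta>\<^sup>2) = tent n t - 1 / real n" for t
    using n by (auto simp: \<delta>_def tent_def max_def field_simps power2_eq_square)
  then have "real n * ((max 0 (\<delta> - t) - \<delta>\<^sup>2) * q) = (tent n t - 1 / real n) * q" for t q
    by (metis mult.assoc)
  ultimately show ?thesis
    by simp
qed

text \<open>The constant 1 stands for \<open>n = 1\<close>, where the arc is the whole circle and
  its autocorrelation is constant; it supplies the first term of \<open>harm L\<close>.\<close>

definition tent_sum :: "nat \<Rightarrow> real \<Rightarrow> real"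
  where "tent_sum L t = 1 + (\<Sum>n=2..L. tent n t)"

lemma tent_sum_nonneg: "0 \<le> tent_sum L t"
  by (auto simp: tent_sum_def tent_def intro!: add_nonneg_nonneg sum_nonneg)

lemma tent_sum_zero:
  assumes "1 \<le> L"
  shows "tent_sum L 0 = real L"
  using assms by (simp add: tent_sum_def tent_def of_nat_diff)

text \<open>While \<open>L * t\<close> is at most 1 no tent is truncated, so the sum is an
  arithmetic progression. The extra \<open>+ t\<close> makes up for the absent \<open>n = 1\<close>
  term.\<close>

lemma tent_sum_eq:
  assumes "1 \<le> L" "real L * t \<le> 1" "0 \<le> t"
  shows "tent_sum L t = real L + t - t * (real L * (real L + 1) / 2)"
  using assms
proof (induction L rule: nat_induct_at_least)
  case base
  then show ?case by (simp add: tent_sum_def)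
next
  case (Suc L)
  have "real L * t \<le> real (Suc L) * t"
    using Suc.prems by (intro mult_right_mono) auto
  then have "tent_sum L t = real L + t - t * (real L * (real L + 1) / 2)"
    using Suc by simp
  moreover have "tent_sum (Suc L) t = tent_sum L t + (1 - real (Suc L) * t)"
    using Suc by (simp add: tent_sum_def tent_def)
  ultimately show ?case
    by (simp add: field_simps)
qed

text \<open>By induction on \<open>L\<close>: either the new tent vanishes at \<open>t\<close>, or
  all tents are still linear there and the closed form applies. For \<open>L = 1\<close> the bound
  is just \<open>t \<le> 1/2\<close>.\<close>

lemma tent_sum_le:
  assumes "1 \<le> L" "0 < t" "t \<le> 1/2"
  shows "tent_sum L t \<le> inverse (2 * t)"
  using assms(1)
proof (induction L rule: nat_induct_at_least)
  case base
  then show ?case using assms by (simp add: tent_sum_def field_simps)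
next
  case (Suc L)
  show ?case
  proof (cases "real (Suc L) * t \<le> 1")
    case True
    define x where "x = real (Suc L)"
    \<comment> \<open>Completing the square in \<open>x * t\<close> leaves
      \<open>t\<^sup>2 * (x - 2)\<close>, nonnegative since \<open>x = L + 1\<close> is at least
      2.\<close>
    have "2 * t * (x + t - t * (x * (x + 1) / 2)) = 1 - ((1 - x * t)\<^sup>2 + t\<^sup>2 * (x - 2))"
      by (simp add: field_simps power2_eq_square)
    moreover have "2 \<le> x"
      using Suc.hyps by (simp add: x_def)
    then have "0 \<le> (1 - x * t)\<^sup>2 + t\<^sup>2 * (x - 2)"
      by (intro add_nonneg_nonneg mult_nonneg_nonneg) simp_all
    ultimately have "2 * t * (x + t - t * (x * (x + 1) / 2)) \<le> 1"
      by simp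
    then have "2 * t * tent_sum (Suc L) t \<le> 1"
      using tent_sum_eq[of "Suc L" t] True assms by (simp add: x_def)
    then show ?thesis
      using assms by (simp add: inverse_eq_divide pos_le_divide_eq mult.commute)
  next
    case False
    then have "tent_sum (Suc L) t = tent_sum L t"
      using Suc by (simp add: tent_sum_def tent_def)
    then show ?thesis using Suc by simp
  qed
qed

lemma harm_eq_one_plus:
  assumes "1 \<le> L"
  shows "(harm L :: real) = 1 + (\<Sum>n=2..L. 1 / real n)"
  using assms by (simp add: harm_def sum.atLeast_Suc_atMost numeral_2_eq_2 inverse_eq_divide)

lemma psd_on_tent_sum_mult:
  assumes "psd_on S Q" "1 \<le> L"
  shows "psd_on S (\<lambda>y z. (tent_sum L (dist_to_int (a y - a z)) - harm L) * Q y z)"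
proof -
  have "psd_on S (\<lambda>y z. \<Sum>n=2..L. (tent n (dist_to_int (a y - a z)) - 1 / real n) * Q y z)"
    by (intro psd_on_sum psd_on_tent_mult assms(1)) simp
  then show ?thesis
    by (simp add: tent_sum_def harm_eq_one_plus[OF assms(2)] sum_subtractf
        flip: sum_distrib_right)
qed

section \<open>Double sums over the set and counting of differences\<close>

lemma sum_prod_tent_sum_ge:
  fixes b :: "'a \<Rightarrow> real_mod_int ^ 'm"
  assumes "1 \<le> L"
  shows "(real (card S))\<^sup>2 * harm L ^ CARD('m)
    \<le> (\<Sum>y\<in>S. \<Sum>z\<in>S. \<Prod>m\<in>UNIV. tent_sum L (dist_to_int (b y $ m - b z $ m)))"
proof -
  have "psd_on S (\<lambda>y z. (\<Prod>m\<in>UNIV. tent_sum L (dist_to_int (b y $ m - b z $ m)))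
      - harm L ^ CARD('m))"
    by (intro psd_on_prod_minus psd_on_tent_sum_mult assms) (simp_all add: harm_nonneg)
  \<comment> \<open>Weights equal to 1 turn positivity into a lower bound for the full double
    sum.\<close>
  from psd_onD[OF this, of "\<lambda>_. 1"] show ?thesis
    by (simp add: sum_subtractf power2_eq_square)
qed

lemma int_scale_diff: "int_scale (k - l) a = int_scale k a - int_scale l a"
  by transfer (simp add: cong_Ints_def left_diff_distrib)

lemma mat_int_vec_diff: "mat_int_vec A (y - z) $ m = mat_int_vec A y $ m - mat_int_vec A z $ m"
  by (simp add: mat_int_vec_def int_scale_diff sum_subtractf)

text \<open>Take \<open>L\<close> to be the integer part of the \<open>M\<close>-th root
  \<open>r\<close> of \<open>K\<close>. Rounding down costs nothing in the logarithm, since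
  \<open>r < L + 1\<close> and \<open>ln (L + 1) \<le> harm L\<close>.\<close>

lemma ex_nat_root_bounds:
  fixes K M :: nat
  assumes "1 \<le> K" "1 \<le> M"
  obtains L where "1 \<le> L" "real L ^ M \<le> real K" "ln (real K) / real M \<le> harm L"
proof
  define r where "r = root M (real K)"
  define L where "L = nat \<lfloor>r\<rfloor>"
  have r: "1 \<le> r" "r ^ M = real K"
    using assms by (simp_all add: r_def)
  then show "1 \<le> L"
    by (simp add: L_def le_nat_floor)
  have L: "real L \<le> r" "r < real L + 1"
    using r(1) by (simp_all add: L_def)
  then show "real L ^ M \<le> real K"
    using power_mono[of "real L" r M] r by simp
  have "ln (real K) / real M = ln r"
    using r assms by (simp flip: r(2) add: ln_realpow)
  also have "\<dots> \<le> ln (real L + 1)"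
    using r L by simp
  also have "\<dots> \<le> harm L"
    by (rule ln_le_harm)
  finally show "ln (real K) / real M \<le> harm L" .
qed

theorem corollary1p2:
  fixes Y :: "(int ^ 'n) set"
    and A :: "real_mod_int ^ 'n ^ 'm"
  assumes "finite Y" and "Y \<noteq> {}"
  shows "ereal (real (card Y) * (ln (real (card Y)) / real CARD('m)) ^ CARD('m) - real (card Y))
           \<le> (\<Sum>\<xi> \<in> difference_set Y - {0}. F (mat_int_vec A \<xi>))"
proof -
  let ?X = "difference_set Y - {0}" and ?K = "real (card Y)" and ?M = "CARD('m)"
  have "difference_set Y = (\<lambda>(y, z). y - z) ` (Y \<times> Y)"
    by (auto simp: difference_set_def)
  then have finX: "finite ?X"
    using assms by simp
  have K: "1 \<le> card Y"
    using assms by (simp add: Suc_le_eq card_gt_0_iff)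
  show ?thesis
  proof (cases "\<exists>\<xi>\<in>?X. F (mat_int_vec A \<xi>) = \<infinity>")
    case True
    then have "(\<Sum>\<xi>\<in>?X. F (mat_int_vec A \<xi>)) = \<infinity>"
      using finX by (simp add: sum_Pinfty)
    then show ?thesis by simp
  next
    case False
    define d where "d = (\<lambda>\<xi> m. dist_to_int (mat_int_vec A \<xi> $ m))"
    \<comment> \<open>\<open>f\<close> is the real value of \<open>F\<close> off 0. At 0,
      \<open>inverse 0 = 0\<close> gives \<open>f 0 = 0\<close> while \<open>P 0\<close> is
      positive, so the diagonal is treated separately.\<close>
    define f where "f = (\<lambda>\<xi>. \<Prod>m\<in>UNIV. inverse (2 * d \<xi> m))"
    obtain L where L: "1 \<le> L" "real L ^ ?M \<le> ?K" "ln ?K / real ?M \<le> harm L"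
      using ex_nat_root_bounds[of "card Y" ?M] K by (metis One_nat_def Suc_leI zero_less_card_finite)
    define P where "P = (\<lambda>\<xi>. \<Prod>m\<in>UNIV. tent_sum L (d \<xi> m))"
    have Ff: "F (mat_int_vec A \<xi>) = ereal (f \<xi>)" "P \<xi> \<le> f \<xi>" "0 \<le> f \<xi>" if "\<xi> \<in> ?X" for \<xi>
    proof -
      have nz: "d \<xi> m \<noteq> 0" for m
        using False that unfolding F_def d_def by metis
      then show "F (mat_int_vec A \<xi>) = ereal (f \<xi>)"
        by (auto simp: F_def f_def d_def)
      have pos: "0 < d \<xi> m" for m
        using nz[of m] dist_to_int_nonneg[of "mat_int_vec A \<xi> $ m"] by (simp add: d_def)
      then show "0 \<le> f \<xi>"
        unfolding f_def by (intro prod_nonneg) (simp add: less_imp_le)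
      show "P \<xi> \<le> f \<xi>"
        unfolding P_def f_def using pos L(1)
        by (intro prod_mono conjI tent_sum_nonneg tent_sum_le)
          (simp_all only: d_def dist_to_int_le_half)
    qed
    have P0: "P 0 = real L ^ ?M"
      using mat_int_vec_diff[of A 0 0] by (simp add: P_def d_def tent_sum_zero[OF L(1)])
    \<comment> \<open>For fixed \<open>z\<close> the map from \<open>y\<close> to
      \<open>y - z\<close> is injective, so each nonzero difference occurs at most once per
      row.\<close>
    have row: "(\<Sum>y\<in>Y. P (y - z)) \<le> ?K + sum f ?X" if "z \<in> Y" for z
    proof -
      have sub: "(\<lambda>y. y - z) ` (Y - {z}) \<subseteq> ?X"
        using that by (auto simp: difference_set_def)
      have "(\<Sum>y\<in>Y. P (y - z)) = P 0 + (\<Sum>y\<in>Y - {z}. P (y - z))"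
        using that assms by (simp add: sum.remove)
      also have "(\<Sum>y\<in>Y - {z}. P (y - z)) = sum P ((\<lambda>y. y - z) ` (Y - {z}))"
        by (subst sum.reindex) (auto simp: inj_on_def)
      also have "\<dots> \<le> sum f ((\<lambda>y. y - z) ` (Y - {z}))"
        using sub Ff by (intro sum_mono) auto
      also have "\<dots> \<le> sum f ?X"
        using sub Ff finX by (intro sum_mono2) auto
      finally show ?thesis
        using P0 L(2) by linarith
    qed
    have "?K\<^sup>2 * harm L ^ ?M \<le> (\<Sum>y\<in>Y. \<Sum>z\<in>Y. P (y - z))"
      using sum_prod_tent_sum_ge[OF L(1), of Y "mat_int_vec A"]
      by (simp add: P_def d_def mat_int_vec_diff)
    also have "\<dots> = (\<Sum>z\<in>Y. \<Sum>y\<in>Y. P (y - z))"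
      by (rule sum.swap)
    also have "\<dots> \<le> (\<Sum>z\<in>Y. ?K + sum f ?X)"
      by (intro sum_mono row)
    also have "\<dots> = ?K * (?K + sum f ?X)"
      by simp
    finally have "?K * (?K * harm L ^ ?M) \<le> ?K * (?K + sum f ?X)"
      by (simp add: power2_eq_square mult.assoc)
    then have "?K * harm L ^ ?M \<le> ?K + sum f ?X"
      using K by (simp only: mult_le_cancel_left_pos)
    \<comment> \<open>Monotonicity of the power uses \<open>ln ?K \<ge> 0\<close>, that is,
      \<open>?K \<ge> 1\<close>.\<close>
    moreover have "?K * (ln ?K / real ?M) ^ ?M \<le> ?K * harm L ^ ?M"
      using K L by (intro mult_left_mono power_mono) auto
    ultimately have "?K * (ln ?K / real ?M) ^ ?M - ?K \<le> sum f ?X"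
      by linarith
    moreover have "(\<Sum>\<xi>\<in>?X. F (mat_int_vec A \<xi>)) = ereal (sum f ?X)"
      unfolding sum_ereal[symmetric] by (rule sum.cong[OF refl Ff(1)])
    ultimately show ?thesis
      by simp
  qed
qed

end
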